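(* Let $D_0$ be a diagram. Suppose there exist $D\in KD(D_0)$ and positive integers $r,r',c,c'$ with $1\le c<c'$ and $1\le r<r'-1$ such that: (1) $(r',c')\in D$ and $(r',\tilde c)\notin D$ for all $\tilde c>c'$; (2) $(\tilde r,c)\in D$ for all $r<\tilde r\le r'$; (3) $(r,c)\notin D$; (4) for each $\tilde r$ with $r<\tilde r<r'-1$ there exists $\tilde c>c$ with $(\tilde r,\tilde c)\in D$; (5) for each $\tilde c>c$ there exists $\tilde r$ with $1\le\tilde r<r'$ and $(\tilde r,\tilde c)\notin D$. Then $\mathcal{P}(D_0)$ is not ranked.
   Context: A diagram is a finite set $D$ of cells $(r,c)$ with $r,c$ positive integers; $r$ is the row (rows numbered from bottom to top starting at 1) and $c$ the column (numbered from left to right starting at 1). A Kohnert move at row $r$ applied to a diagram $D$: if row $r$ of $D$ is empty, $D$ is unchanged; otherwise let $(r,c)$ be the cell of row $r$ with the largest column index; if every position $(r',c)$ with $1\le r'<r$ belongs to $D$, then $D$ is unchanged; otherwise let $r'$ be the largest integer with $1\le r'<r$ and $(r',c)\notin D$, and the move replaces the cell $(r,c)$ by $(r',c)$. For a diagram $D_0$, $KD(D_0)$ is the set of all diagrams obtainable from $D_0$ by finite (possibly empty) sequences of Kohnert moves. The Kohnert poset $\mathcal{P}(D_0)$ is $KD(D_0)$ ordered by $D_2\preceq D_1$ iff $D_2$ can be obtained from $D_1$ by a finite sequence of Kohnert moves. A finite poset $P$ is ranked if there is a function $\rho:P\to\mathbb{Z}_{\ge0}$ such that $x\prec y$ implies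 $\rho(x)<\rho(y)$ and $\rho(y)=\rho(x)+1$ whenever $y$ covers $x$. *)

theory Defs
  imports Main
begin

text \<open>A cell is a pair (row, column); rows are counted from bottom to top and columns from left
  to right, both starting at 1.\<close>

type_synonym cell = "nat \<times> nat"

definition diagram :: "cell set \<Rightarrow> bool" where
  "diagram D \<longleftrightarrow> finite D \<and> (\<forall>(r, c) \<in> D. 1 \<le> r \<and> 1 \<le> c)"

text \<open>Both uses of \<open>Max\<close> below are applied to finite nonempty sets when \<open>D\<close> is a diagram.\<close>

definition kohnert_move :: "nat \<Rightarrow> cell set \<Rightarrow> cell set" where
  "kohnert_move r D =
    (if {c. (r, c) \<in> D} = {} then D
     else let c = Max {c. (r, c) \<in> D};
              gaps = {r'. 1 \<le> r' \<and> r' < r \<and> (r', c) \<notin> D}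
          in if gaps = {} then D else insert (Max gaps, c) (D - {(r, c)}))"

inductive_set KD :: "cell set \<Rightarrow> cell set set" for D0 :: "cell set" where
  refl: "D0 \<in> KD D0"
| step: "D \<in> KD D0 \<Longrightarrow> 1 \<le> r \<Longrightarrow> kohnert_move r D \<in> KD D0"

text \<open>The order as a relation with field \<open>KD D0\<close>: a pair (D2, D1) means that D2 is below D1.\<close>

definition kohnert_poset :: "cell set \<Rightarrow> cell set rel" where
  "kohnert_poset D0 = {(D2, D1). D1 \<in> KD D0 \<and> D2 \<in> KD D0 \<and> D2 \<in> KD D1}"

text \<open>In a relation \<open>R\<close> read as a (non-strict) partial order, \<open>covers R y x\<close> means that
  \<open>y\<close> covers \<open>x\<close>.\<close>

definition covers :: "'a rel \<Rightarrow> 'a \<Rightarrow> 'a \<Rightarrow> bool" where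
  "covers R y x \<longleftrightarrow> (x, y) \<in> R \<and> x \<noteq> y \<and>
    \<not> (\<exists>z. (x, z) \<in> R \<and> x \<noteq> z \<and> (z, y) \<in> R \<and> z \<noteq> y)"

text \<open>Only the values of \<open>\<rho>\<close> on the field of \<open>R\<close> matter.\<close>

definition ranked :: "'a rel \<Rightarrow> bool" where
  "ranked R \<longleftrightarrow> (\<exists>\<rho> :: 'a \<Rightarrow> nat.
    (\<forall>x y. (x, y) \<in> R \<and> x \<noteq> y \<longrightarrow> \<rho> x < \<rho> y) \<and>
    (\<forall>x y. covers R y x \<longrightarrow> \<rho> y = \<rho> x + 1))"

lemma kohnert_move_cases:
  assumes "diagram D"
  obtains "kohnert_move r D = D"
  | r' c where "(r, c) \<in> D" "(r', c) \<notin> D" "1 \<le> r'" "r' < r"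
      "kohnert_move r D = insert (r', c) (D - {(r, c)})"
proof -
  define c where "c = Max {c. (r, c) \<in> D}"
  define G where "G = {r'. 1 \<le> r' \<and> r' < r \<and> (r', c) \<notin> D}"
  show thesis
  proof (cases "{c. (r, c) \<in> D} = {} \<or> G = {}")
    case True
    then have "kohnert_move r D = D"
      by (auto simp: kohnert_move_def Let_def G_def c_def)
    then show ?thesis by (rule that(1))
  next
    case False
    have "finite {c. (r, c) \<in> D}"
    proof (rule finite_subset)
      show "{c. (r, c) \<in> D} \<subseteq> snd ` D" by force
      show "finite (snd ` D)" using assms by (simp add: diagram_def)
    qed
    then have c: "(r, c) \<in> D" using Max_in[of "{c. (r, c) \<in> D}"] False unfolding c_def by blast
    have "finite G" unfolding G_def by simp
    then have "Max G \<in> G" using False by (intro Max_in) auto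
    moreover have "kohnert_move r D = insert (Max G, c) (D - {(r, c)})"
      unfolding kohnert_move_def Let_def using False
      by (simp only: c_def[symmetric] G_def[symmetric] if_False de_Morgan_disj)
    ultimately show ?thesis using c that(2)[of c "Max G"] unfolding G_def by blast
  qed
qed

lemma kohnert_move_weight:
  assumes "diagram D"
  shows "kohnert_move r D = D \<or> sum fst (kohnert_move r D) < sum fst D"
  using assms
proof (cases rule: kohnert_move_cases[where r = r])
  case (2 r' c)
  have fin: "finite D" using assms by (simp add: diagram_def)
  have "sum fst (kohnert_move r D) = r' + sum fst (D - {(r, c)})"
    using 2 fin by simp
  moreover have "sum fst D = r + sum fst (D - {(r, c)})"
    using 2 fin sum.remove[of D "(r, c)" fst] by simp
  ultimately show ?thesis using 2 by simp
qed simp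

lemma kohnert_move_box:
  assumes "diagram D" "D \<subseteq> {..m} \<times> {..n}"
  shows "diagram (kohnert_move r D) \<and> kohnert_move r D \<subseteq> {..m} \<times> {..n}"
  using assms(1)
proof (cases rule: kohnert_move_cases[where r = r])
  case (2 r' c)
  have "r \<le> m" "c \<le> n" "1 \<le> c" using assms 2(1) by (auto simp: diagram_def)
  moreover have "r' \<le> m" using 2(4) \<open>r \<le> m\<close> by simp
  ultimately show ?thesis
    using assms 2(3) unfolding 2(5) diagram_def by blast
qed (use assms in simp)

lemma KD_box:
  assumes "D \<in> KD D0" "diagram D0" "D0 \<subseteq> {..m} \<times> {..n}"
  shows "diagram D \<and> D \<subseteq> {..m} \<times> {..n}"
  using assms
proof induction
  case (step D r)
  then show ?case by (intro kohnert_move_box) simp_all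
qed simp

lemma diagram_box:
  assumes "diagram D"
  obtains m n where "D \<subseteq> {..m} \<times> {..n}"
proof
  have "finite (fst ` D)" "finite (snd ` D)" using assms by (simp_all add: diagram_def)
  then have "fst x \<le> Max (fst ` D) \<and> snd x \<le> Max (snd ` D)" if "x \<in> D" for x
    using that by (meson Max_ge imageI)
  then show "D \<subseteq> {..Max (fst ` D)} \<times> {..Max (snd ` D)}"
    by fastforce
qed

lemma KD_diagram: "D \<in> KD D0 \<Longrightarrow> diagram D0 \<Longrightarrow> diagram D"
  by (meson KD_box diagram_box)

lemma finite_KD:
  assumes "diagram D0"
  shows "finite (KD D0)"
proof -
  obtain m n where "D0 \<subseteq> {..m} \<times> {..n}" using diagram_box[OF assms] by blast
  then have "KD D0 \<subseteq> Pow ({..m} \<times> {..n})" using KD_box[OF _ assms] by blast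
  then show ?thesis by (rule finite_subset) simp
qed

lemma KD_trans: "D2 \<in> KD D1 \<Longrightarrow> D1 \<in> KD D0 \<Longrightarrow> D2 \<in> KD D0"
  by (induction rule: KD.induct) (simp_all add: KD.step)

lemma KD_weight:
  assumes "D \<in> KD D0" "diagram D0"
  shows "D = D0 \<or> sum fst D < sum fst D0"
  using assms
proof induction
  case (step D r)
  then show ?case using kohnert_move_weight[of D r] KD_diagram[of D D0]
    by (metis order_less_trans)
qed simp

lemma partial_order_kohnert_poset:
  assumes "diagram D0"
  shows "partial_order_on (KD D0) (kohnert_poset D0)"
  unfolding partial_order_on_def preorder_on_def
proof (intro conjI)
  show "refl_on (KD D0) (kohnert_poset D0)"
    by (auto simp: refl_on_def kohnert_poset_def intro: KD.refl)
  show "kohnert_poset D0 \<subseteq> KD D0 \<times> KD D0" by (auto simp: kohnert_poset_def)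
  show "trans (kohnert_poset D0)"
    by (auto simp: trans_def kohnert_poset_def intro: KD_trans)
  show "antisym (kohnert_poset D0)"
  proof (rule antisymI)
    fix x y
    assume "(x, y) \<in> kohnert_poset D0" "(y, x) \<in> kohnert_poset D0"
    then have "x \<in> KD y" "y \<in> KD x" "diagram x" "diagram y"
      using KD_diagram[OF _ assms] by (auto simp: kohnert_poset_def)
    then show "x = y" using KD_weight[of x y] KD_weight[of y x] by (metis less_asym)
  qed
qed

end

theory Submission
  imports Defs
begin

text \<open>Moves in row \<open>r' - 1\<close> first clear that row to the right of column \<open>c\<close>. Let \<open>k \<ge> 1\<close> be the number
  of cells of row \<open>r'\<close> to the right of \<open>c\<close>; each of them now drops to row \<open>r' - 1\<close> in one move, a
  cover as the sum of all row indices goes down by one. After these \<open>k\<close> covers, each of the rows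
  \<open>r + 1, \<dots>, r' - 1\<close> has a cell to the right of \<open>c\<close>, so that none of the cells of column \<open>c\<close> in
  these rows can move, and the move of \<open>(r', c)\<close> to \<open>(r, c)\<close> is a cover too. The same diagram is
  reached in \<open>k + 2\<close> moves by sending \<open>(r' - 1, c)\<close> to \<open>(r, c)\<close> first, then lowering the \<open>k\<close> cells,
  and finally sending \<open>(r', c)\<close> to \<open>(r' - 1, c)\<close>.\<close>

section \<open>Rightmost cells, highest gaps and effective moves\<close>

lemma Max_row_eqI:
  fixes D :: "cell set"
  assumes "(x, c) \<in> D" "\<forall>c1>c. (x, c1) \<notin> D"
  shows "Max {c. (x, c) \<in> D} = c"
proof -
  have "{c. (x, c) \<in> D} \<subseteq> {..c}" using assms(2) leI by blast
  then show ?thesis using assms(1) by (intro Max_eqI) (auto intro: finite_subset)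
qed

lemma kohnert_move_eqI:
  assumes "(x, c) \<in> D" "\<forall>c1>c. (x, c1) \<notin> D"
    and "1 \<le> y" "y < x" "(y, c) \<notin> D" "\<forall>z. y < z \<and> z < x \<longrightarrow> (z, c) \<in> D"
  shows "kohnert_move x D = insert (y, c) (D - {(x, c)})"
proof -
  let ?G = "{r'. 1 \<le> r' \<and> r' < x \<and> (r', c) \<notin> D}"
  have "Max ?G = y"
  proof (rule Max_eqI)
    show "z \<le> y" if "z \<in> ?G" for z using that assms(6) leI by blast
  qed (use assms in auto)
  moreover have "?G \<noteq> {}" "{c. (x, c) \<in> D} \<noteq> {}" using assms by auto
  ultimately show ?thesis unfolding kohnert_move_def Max_row_eqI[OF assms(1,2)] Let_def by (simp only: if_False)
qed

lemma rightmost_cell: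
  assumes "diagram D" "(x, c) \<in> D"
  obtains m where "c \<le> m" "(x, m) \<in> D" "\<forall>c1>m. (x, c1) \<notin> D"
proof -
  let ?C = "{c. (x, c) \<in> D}"
  have "?C \<subseteq> snd ` D" by force
  then have fin: "finite ?C" using assms(1) by (auto simp: diagram_def intro: finite_subset)
  have "c \<le> Max ?C" "Max ?C \<in> ?C" using Max_ge[OF fin] Max_in[OF fin] assms(2) by auto
  moreover have "\<forall>c1>Max ?C. (x, c1) \<notin> D" using Max_ge[OF fin] leD by blast
  ultimately show thesis using that by blast
qed

lemma highest_gap:
  fixes D :: "cell set"
  assumes "1 \<le> g" "g < x" "(g, c) \<notin> D"
  obtains y where "1 \<le> y" "y < x" "(y, c) \<notin> D" "\<forall>z. y < z \<and> z < x \<longrightarrow> (z, c) \<in> D"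
proof -
  let ?G = "{g. 1 \<le> g \<and> g < x \<and> (g, c) \<notin> D}"
  have fin: "finite ?G" by simp
  have "Max ?G \<in> ?G" using Max_in[OF fin] assms by blast
  moreover have "(z, c) \<in> D" if "Max ?G < z" "z < x" for z
  proof (rule ccontr)
    assume "(z, c) \<notin> D"
    then have "z \<in> ?G" using that \<open>Max ?G \<in> ?G\<close> by simp
    then show False using Max_ge[OF fin] that(1) leD by blast
  qed
  ultimately show thesis using that by blast
qed

text \<open>Sharper than \<open>kohnert_move_cases\<close>: it retains that the moved cell is
  rightmost in its row, which is what later excludes the blocked rows.\<close>

lemma kohnert_move_neqE:
  assumes "diagram D" "kohnert_move x D \<noteq> D"
  obtains y c where "(x, c) \<in> D" "\<forall>c1>c. (x, c1) \<notin> D"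
    "1 \<le> y" "y < x" "(y, c) \<notin> D" "\<forall>z. y < z \<and> z < x \<longrightarrow> (z, c) \<in> D"
    "kohnert_move x D = insert (y, c) (D - {(x, c)})"
proof -
  have "\<exists>c0. (x, c0) \<in> D"
    by (rule ccontr) (use assms(2) in \<open>simp add: kohnert_move_def\<close>)
  then obtain c where c: "(x, c) \<in> D" "\<forall>c1>c. (x, c1) \<notin> D"
    using rightmost_cell[OF assms(1)] by metis
  have m: "Max {c. (x, c) \<in> D} = c" using Max_row_eqI[OF c] .
  obtain g where "1 \<le> g" "g < x" "(g, c) \<notin> D"
    using assms(2) by (auto simp: kohnert_move_def Let_def m split: if_splits)
  then obtain y where y: "1 \<le> y" "y < x" "(y, c) \<notin> D" "\<forall>z. y < z \<and> z < x \<longrightarrow> (z, c) \<in> D"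
    by (rule highest_gap)
  show thesis by (rule that[OF c y kohnert_move_eqI[OF c y]])
qed

lemma diagram_kohnert_move:
  assumes "diagram D"
  shows "diagram (kohnert_move x D)"
  using assms(1)
proof (cases rule: kohnert_move_cases[where r = x])
  case (2 y c)
  then show ?thesis using assms unfolding 2(5) diagram_def by auto
qed (use assms in simp)

section \<open>Criteria for covers in the Kohnert poset\<close>

lemma KD_first_move:
  assumes "E \<in> KD D" "E \<noteq> D"
  obtains x where "1 \<le> x" "kohnert_move x D \<noteq> D" "E \<in> KD (kohnert_move x D)"
proof -
  have "E = D \<or> (\<exists>x\<ge>1. kohnert_move x D \<noteq> D \<and> E \<in> KD (kohnert_move x D))"
    using assms(1)
  proof induction
    case (step E r)
    then show ?case by (metis KD.refl KD.step)
  qed simp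
  then show ?thesis using assms(2) that by blast
qed

text \<open>A diagram \<open>z\<close> strictly between would be reached through an effective first
  move from \<open>D\<close>, after which \<open>E\<close> is still reachable. By
  \<open>only\<close> that move already gives \<open>E\<close>, so \<open>z\<close> and
  \<open>E\<close> are reachable from each other, which the strictly falling sum of rows
  forbids.\<close>

lemma covers_kohnert_posetI:
  assumes D: "diagram D0" "D \<in> KD D0"
    and E: "E \<in> KD D" "E \<noteq> D"
    and only: "\<And>x. kohnert_move x D \<noteq> D \<Longrightarrow> E \<in> KD (kohnert_move x D) \<Longrightarrow> kohnert_move x D = E"
  shows "covers (kohnert_poset D0) D E"
  unfolding covers_def
proof (intro conjI notI)
  show "(E, D) \<in> kohnert_poset D0" using D E KD_trans by (auto simp: kohnert_poset_def)
next
  assume "\<exists>z. (E, z) \<in> kohnert_poset D0 \<and> E \<noteq> z \<and> (z, D) \<in> kohnert_poset D0 \<and> z \<noteq> D"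
  then obtain z where z: "E \<in> KD z" "E \<noteq> z" "z \<in> KD D" "z \<noteq> D" "z \<in> KD D0" "E \<in> KD D0"
    by (auto simp: kohnert_poset_def)
  obtain x where "kohnert_move x D \<noteq> D" "z \<in> KD (kohnert_move x D)"
    using KD_first_move[OF z(3,4)] by blast
  moreover from this have "kohnert_move x D = E" using only KD_trans[OF z(1)] by blast
  ultimately have "z \<in> KD E" by simp
  moreover have "diagram z" "diagram E" using z D(1) KD_diagram by blast+
  ultimately show False using z(1,2) KD_weight[of z E] KD_weight[of E z] by (metis less_asym)
qed (use E in simp)

lemma sum_fst_move_cell:
  assumes "finite D" "(x, c) \<in> D" "(y, c) \<notin> D"
  shows "sum fst (insert (y, c) (D - {(x, c)})) + x = sum fst D + y"
  using assms sum.remove[of D "(x, c)" fst] by (simp add: ac_simps)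

lemma covers_unit_move:
  assumes "diagram D0" "D \<in> KD D0"
    and "1 \<le> s" "(Suc s, c) \<in> D" "\<forall>c1>c. (Suc s, c1) \<notin> D" "(s, c) \<notin> D"
  shows "covers (kohnert_poset D0) D (insert (s, c) (D - {(Suc s, c)}))"
proof -
  let ?E = "insert (s, c) (D - {(Suc s, c)})"
  have D: "diagram D" using KD_diagram assms by blast
  then have w: "Suc (sum fst ?E) = sum fst D"
    using sum_fst_move_cell[of D "Suc s" c s] assms by (simp add: diagram_def)
  have "kohnert_move (Suc s) D = ?E" by (rule kohnert_move_eqI) (use assms in auto)
  then have E: "?E \<in> KD D" using KD.step[OF KD.refl, of "Suc s" D] by simp
  show ?thesis
  proof (rule covers_kohnert_posetI[OF assms(1,2) E])
    show "?E \<noteq> D" using assms(6) by blast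
    fix x
    assume "kohnert_move x D \<noteq> D" and F: "?E \<in> KD (kohnert_move x D)"
    then have lt: "sum fst (kohnert_move x D) < sum fst D" using kohnert_move_weight[OF D] by blast
    have "diagram (kohnert_move x D)" using diagram_kohnert_move[OF D] .
    \<comment> \<open>The first move has already spent the single unit of weight, so no effective
      move is left on the way to \<open>?E\<close>.\<close>
    moreover have "\<not> sum fst ?E < sum fst (kohnert_move x D)" using lt w by linarith
    ultimately show "kohnert_move x D = ?E" using KD_weight[OF F] by simp
  qed
qed

section \<open>Column counts as an obstruction to reachability\<close>

definition cells_upto :: "cell set \<Rightarrow> nat \<Rightarrow> nat \<Rightarrow> nat" where
  "cells_upto D c y = card {x. x \<le> y \<and> (x, c) \<in> D}"

lemma cells_upto_move:
  fixes D :: "cell set"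
  assumes "(x, c0) \<in> D" "(y0, c0) \<notin> D" "y0 < x"
  defines "F \<equiv> insert (y0, c0) (D - {(x, c0)})"
  shows "cells_upto F c y = cells_upto D c y + (if c = c0 \<and> y0 \<le> y \<and> y < x then 1 else 0)"
proof (cases "c = c0 \<and> y0 \<le> y")
  case True
  let ?S = "{z. z \<le> y \<and> (z, c0) \<in> D}"
  have fin: "finite ?S" by simp
  have "{z. z \<le> y \<and> (z, c) \<in> F} = insert y0 (?S - {x})" using True unfolding F_def by auto
  moreover have "card (insert y0 (?S - {x})) = Suc (card (?S - {x}))" using assms(2) fin by simp
  moreover have "card (?S - {x}) + (if x \<le> y then 1 else 0) = card ?S"
    using assms(1) fin card_Suc_Diff1[of ?S x] by auto
  ultimately show ?thesis using True unfolding cells_upto_def by (auto split: if_splits)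
next
  case False
  then have "{z. z \<le> y \<and> (z, c) \<in> F} = {z. z \<le> y \<and> (z, c) \<in> D}"
    using assms(3) unfolding F_def by auto
  then show ?thesis using False unfolding cells_upto_def by auto
qed

text \<open>Moves carry cells downward within their columns, so at no level can a cell leave the
  part being counted.\<close>

lemma cells_upto_KD_mono:
  assumes "E \<in> KD D" "diagram D"
  shows "cells_upto D c y \<le> cells_upto E c y"
  using assms
proof induction
  case (step E r)
  have "cells_upto E c y \<le> cells_upto (kohnert_move r E) c y"
  proof (cases rule: kohnert_move_cases[OF KD_diagram[OF step(1,4)], of r])
    case (2 r' c0)
    then show ?thesis using cells_upto_move[of r c0 E r'] by simp
  qed simp
  then show ?case using step by simp
qed simp

text \<open>A first move of a cell other than \<open>(t, c)\<close> would have to stay in column \<open>c\<close> and between the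
  rows \<open>r\<close> and \<open>t\<close>, since otherwise it would raise a count \<^term>\<open>cells_upto\<close> that is the same in both
  diagrams.\<close>

lemma covers_long_move:
  assumes D0: "diagram D0" "D \<in> KD D0"
    and r: "1 \<le> r" "r < t" "(r, c) \<notin> D"
    and col: "\<forall>x. r < x \<and> x \<le> t \<longrightarrow> (x, c) \<in> D"
    and top: "\<forall>c1>c. (t, c1) \<notin> D"
    and blocked: "\<forall>x. r < x \<and> x < t \<longrightarrow> (\<exists>c1>c. (x, c1) \<in> D)"
  shows "covers (kohnert_poset D0) D (insert (r, c) (D - {(t, c)}))"
proof -
  let ?E = "insert (r, c) (D - {(t, c)})"
  have D: "diagram D" using KD_diagram D0 by blast
  have tc: "(t, c) \<in> D" using r col by blast
  have "kohnert_move t D = ?E" by (rule kohnert_move_eqI) (use assms in auto)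
  then have E: "?E \<in> KD D" using KD.step[OF KD.refl, of t D] r by simp
  have cE: "cells_upto ?E c1 y = cells_upto D c1 y + (if c1 = c \<and> r \<le> y \<and> y < t then 1 else 0)"
    for c1 y using cells_upto_move[OF tc r(3,2)] .
  show ?thesis
  proof (rule covers_kohnert_posetI[OF D0 E])
    show "?E \<noteq> D" using r by blast
    fix x
    assume ne: "kohnert_move x D \<noteq> D" and EF: "?E \<in> KD (kohnert_move x D)"
    obtain y c0 where m: "(x, c0) \<in> D" "\<forall>c1>c0. (x, c1) \<notin> D"
      "1 \<le> y" "y < x" "(y, c0) \<notin> D" "\<forall>z. y < z \<and> z < x \<longrightarrow> (z, c0) \<in> D"
      and F: "kohnert_move x D = insert (y, c0) (D - {(x, c0)})"
      using kohnert_move_neqE[OF D ne] by metis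
    have "diagram (kohnert_move x D)" using diagram_kohnert_move[OF D] .
    then have le: "cells_upto (kohnert_move x D) c1 z \<le> cells_upto ?E c1 z" for c1 z
      by (rule cells_upto_KD_mono[OF EF])
    have in_range: "c0 = c \<and> r \<le> z \<and> z < t" if "y \<le> z" "z < x" for z
      using le[of c0 z] that cE[of c0 z] cells_upto_move[OF m(1,5,4), of c0 z] unfolding F
      by (auto split: if_splits)
    \<comment> \<open>The move raises the counts at levels \<open>y\<close> to \<open>x - 1\<close>;
      testing the two extreme levels bounds both rows.\<close>
    have "c0 = c" "r \<le> y" using in_range[of y] m(4) by auto
    moreover have "x - 1 < t" using in_range[of "x - 1"] m(4) by simp
    then have "x \<le> t" by linarith
    \<comment> \<open>If \<open>x < t\<close>, row \<open>x\<close> would have a cell to the right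
      of \<open>c\<close>, yet the moved cell is its rightmost one.\<close>
    ultimately have "x = t" using blocked m(2,4) by (meson le_less_trans le_neq_implies_less)
    moreover have "y = r" using col m(4,5) \<open>r \<le> y\<close> \<open>c0 = c\<close> \<open>x = t\<close> by (metis le_less order_less_imp_le)
    ultimately show "kohnert_move x D = ?E" using F \<open>c0 = c\<close> by simp
  qed
qed

section \<open>Dropping the right end of a row by one\<close>

text \<open>A closed form of the final diagram, so that the two chains can be compared cell by cell
  without tracking intermediate moves.\<close>

definition lower_right :: "nat \<Rightarrow> nat \<Rightarrow> cell set \<Rightarrow> cell set" where
  "lower_right s c D = {(x, c1) \<in> D. \<not> (x = Suc s \<and> c < c1)} \<union> {(s, c1) | c1. c < c1 \<and> (Suc s, c1) \<in> D}"

lemma mem_lower_right: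
  "(x, c1) \<in> lower_right s c D \<longleftrightarrow>
    (x, c1) \<in> D \<and> \<not> (x = Suc s \<and> c < c1) \<or> x = s \<and> c < c1 \<and> (Suc s, c1) \<in> D"
  unfolding lower_right_def by blast

text \<open>Induction on the number of cells to drop, always taking the rightmost. The last
  hypothesis keeps the position below it free, so each drop is a unit cover and costs exactly one
  rank.\<close>

lemma ranked_lower_right:
  fixes \<rho> :: "cell set \<Rightarrow> nat"
  assumes rank: "\<And>x y. covers (kohnert_poset D0) y x \<Longrightarrow> \<rho> y = \<rho> x + 1"
    and "diagram D0" "D \<in> KD D0" "1 \<le> s"
    and "\<forall>c1>c. \<not> ((s, c1) \<in> D \<and> (Suc s, c1) \<in> D)"
  shows "lower_right s c D \<in> KD D0 \<and>
    \<rho> D = \<rho> (lower_right s c D) + card {c1. c < c1 \<and> (Suc s, c1) \<in> D}"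
  using assms(3,5)
proof (induction "card {c1. c < c1 \<and> (Suc s, c1) \<in> D}" arbitrary: D)
  case (0 D)
  \<comment> \<open>Finiteness is needed here because \<open>card\<close> is also 0 on infinite
    sets.\<close>
  have "{c1. c < c1 \<and> (Suc s, c1) \<in> D} \<subseteq> snd ` D" by force
  moreover have "finite (snd ` D)" using KD_diagram[OF 0(2) assms(2)] by (simp add: diagram_def)
  ultimately have "finite {c1. c < c1 \<and> (Suc s, c1) \<in> D}" by (rule finite_subset)
  then have "{c1. c < c1 \<and> (Suc s, c1) \<in> D} = {}" using 0(1) by (metis card_0_eq)
  then have "lower_right s c D = D" unfolding lower_right_def by auto
  then show ?case using 0(1,2) by simp
next
  case (Suc n D)
  let ?R = "{c1. c < c1 \<and> (Suc s, c1) \<in> D}"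
  have fin: "finite ?R" by (rule card_ge_0_finite) (use Suc(2) in linarith)
  have "?R \<noteq> {}" using Suc(2) by (metis card.empty nat.distinct(1))
  then obtain c0 where c0: "c < c0" "(Suc s, c0) \<in> D" by auto
  obtain m where "c0 \<le> m" and "(Suc s, m) \<in> D" and right: "\<forall>c1>m. (Suc s, c1) \<notin> D"
    using rightmost_cell[OF KD_diagram[OF Suc(3) assms(2)] c0(2)] .
  then have m: "c < m" "(Suc s, m) \<in> D" using c0(1) by simp_all
  have sm: "(s, m) \<notin> D" using m Suc(4) by blast
  define E where "E = insert (s, m) (D - {(Suc s, m)})"
  have cov: "covers (kohnert_poset D0) D E"
    unfolding E_def using covers_unit_move[OF assms(2) Suc(3) assms(4) m(2) right sm] .
  then have E: "E \<in> KD D0" by (simp add: covers_def kohnert_poset_def)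
  have RE: "{c1. c < c1 \<and> (Suc s, c1) \<in> E} = ?R - {m}" unfolding E_def by auto
  have "card ?R = Suc (card (?R - {m}))" using m fin card_Suc_Diff1[of ?R m] by simp
  then have n: "n = card {c1. c < c1 \<and> (Suc s, c1) \<in> E}" unfolding RE using Suc(2) by simp
  have dis: "\<forall>c1>c. \<not> ((s, c1) \<in> E \<and> (Suc s, c1) \<in> E)" using Suc(4) unfolding E_def by auto
  \<comment> \<open>The cell dropped first already lies where \<open>lower_right\<close> would put
    it, so the target of the induction stays fixed.\<close>
  have same: "lower_right s c E = lower_right s c D"
  proof (rule set_eqI, clarify)
    fix x c1
    show "(x, c1) \<in> lower_right s c E \<longleftrightarrow> (x, c1) \<in> lower_right s c D"
      by (cases "c1 = m") (use m in \<open>auto simp: mem_lower_right E_def\<close>)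
  qed
  show ?case
    using Suc(1)[OF n E dis] rank[OF cov] unfolding same n[symmetric] Suc(2)[symmetric] by simp
qed

section \<open>Clearing a row to the right of a column\<close>

text \<open>Repeated moves in row \<open>s\<close> send its rightmost cell into a gap below as long
  as that cell lies right of \<open>c\<close>. Only row \<open>s\<close> loses cells, and only rows
  below it gain any.\<close>

lemma clear_row_right:
  assumes "diagram D0" "D \<in> KD D0" "\<forall>c1>c. \<exists>x\<ge>1. x \<le> s \<and> (x, c1) \<notin> D"
  obtains E where "E \<in> KD D0" "\<forall>c1>c. (s, c1) \<notin> E"
    "\<forall>x c1. x \<noteq> s \<longrightarrow> (x, c1) \<in> D \<longrightarrow> (x, c1) \<in> E"
    "\<forall>x c1. c1 \<le> c \<or> s < x \<longrightarrow> ((x, c1) \<in> E \<longleftrightarrow> (x, c1) \<in> D)"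
proof -
  have "\<exists>E. E \<in> KD D0 \<and> (\<forall>c1>c. (s, c1) \<notin> E) \<and>
    (\<forall>x c1. x \<noteq> s \<longrightarrow> (x, c1) \<in> D \<longrightarrow> (x, c1) \<in> E) \<and>
    (\<forall>x c1. c1 \<le> c \<or> s < x \<longrightarrow> ((x, c1) \<in> E \<longleftrightarrow> (x, c1) \<in> D))"
    using assms(2,3)
  proof (induction "card {c1. c < c1 \<and> (s, c1) \<in> D}" arbitrary: D rule: less_induct)
    case (less D)
    let ?R = "{c1. c < c1 \<and> (s, c1) \<in> D}"
    have D: "diagram D" using less(2) assms(1) KD_diagram by blast
    show ?case
    proof (cases "?R = {}")
      case True
      then show ?thesis using less(2) by blast
    next
      case False
      then obtain c0 where c0: "c < c0" "(s, c0) \<in> D" by auto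
      obtain m where "c0 \<le> m" and sm: "(s, m) \<in> D" and right: "\<forall>c1>m. (s, c1) \<notin> D"
        using rightmost_cell[OF D c0(2)] .
      then have m: "c < m" using c0(1) by simp
      obtain g where g: "1 \<le> g" "g \<le> s" "(g, m) \<notin> D" using less(3) m by blast
      then have "g < s" using sm by (auto simp: le_less)
      obtain y where y: "1 \<le> y" "y < s" "(y, m) \<notin> D" "\<forall>z. y < z \<and> z < s \<longrightarrow> (z, m) \<in> D"
        using highest_gap[OF g(1) \<open>g < s\<close> g(3)] .
      define F where "F = insert (y, m) (D - {(s, m)})"
      have "kohnert_move s D = F"
        unfolding F_def using kohnert_move_eqI[OF sm right y] .
      then have F: "F \<in> KD D0" using KD.step[OF less(2), of s] y by simp
      have "{c1. c < c1 \<and> (s, c1) \<in> F} = ?R - {m}" using y unfolding F_def by auto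
      moreover have "?R \<subseteq> snd ` D" by force
      then have "finite ?R" using D by (auto simp: diagram_def intro: finite_subset)
      then have "card (?R - {m}) < card ?R" using m sm by (intro card_Diff1_less) simp_all
      ultimately have "card {c1. c < c1 \<and> (s, c1) \<in> F} < card ?R" by simp
      \<comment> \<open>The gap hypothesis survives the move: in column \<open>m\<close> the vacated
        position \<open>(s, m)\<close> is a new gap, and other columns are unchanged.\<close>
      moreover have "\<exists>x\<ge>1. x \<le> s \<and> (x, c1) \<notin> F" if "c < c1" for c1
      proof (cases "c1 = m")
        case True
        then show ?thesis using y by (intro exI[of _ s]) (simp add: F_def)
      next
        case False
        then show ?thesis using less(3) that by (auto simp: F_def)
      qed
      ultimately obtain E where E: "E \<in> KD D0" "\<forall>c1>c. (s, c1) \<notin> E"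
        "\<forall>x c1. x \<noteq> s \<longrightarrow> (x, c1) \<in> F \<longrightarrow> (x, c1) \<in> E"
        "\<forall>x c1. c1 \<le> c \<or> s < x \<longrightarrow> ((x, c1) \<in> E \<longleftrightarrow> (x, c1) \<in> F)"
        using less(1)[OF _ F] by blast
      have "(x, c1) \<in> F" if "x \<noteq> s" "(x, c1) \<in> D" for x c1 using that by (simp add: F_def)
      moreover have "(x, c1) \<in> F \<longleftrightarrow> (x, c1) \<in> D" if "c1 \<le> c \<or> s < x" for x c1
        using that m y(2) by (auto simp: F_def)
      ultimately show ?thesis using E by (intro exI[of _ E]) simp
    qed
  qed
  then show thesis using that by blast
qed

section \<open>The two chains and the contradiction\<close>

text \<open>The hypothesis \<open>clear\<close> lets the cells of row \<open>Suc s\<close> right of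
  \<open>c\<close> drop by one, and makes \<open>(s, c)\<close> rightmost, so that the second chain
  can start with it.\<close>

lemma not_ranked_if_row_clear:
  assumes D0: "diagram D0" "D \<in> KD D0"
    and r: "1 \<le> r" "r < s" "(r, c) \<notin> D"
    and top: "c < c'" "(Suc s, c') \<in> D"
    and col: "\<forall>x. r < x \<and> x \<le> Suc s \<longrightarrow> (x, c) \<in> D"
    and blocked: "\<forall>x. r < x \<and> x < s \<longrightarrow> (\<exists>c1>c. (x, c1) \<in> D)"
    and clear: "\<forall>c1>c. (s, c1) \<notin> D"
  shows "\<not> ranked (kohnert_poset D0)"
proof
  assume "ranked (kohnert_poset D0)"
  then obtain \<rho> :: "cell set \<Rightarrow> nat"
    where mono: "\<And>x y. (x, y) \<in> kohnert_poset D0 \<Longrightarrow> x \<noteq> y \<Longrightarrow> \<rho> x < \<rho> y"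
      and cov: "\<And>x y. covers (kohnert_poset D0) y x \<Longrightarrow> \<rho> y = \<rho> x + 1"
    unfolding ranked_def by blast
  define k where "k = card {c1. c < c1 \<and> (Suc s, c1) \<in> D}"
  have s: "1 \<le> s" using r by simp
  define A where "A = lower_right s c D"
  have A: "A \<in> KD D0" "\<rho> D = \<rho> A + k"
    using ranked_lower_right[where \<rho> = \<rho>, OF cov D0 s] clear unfolding A_def k_def by auto
  define E where "E = insert (r, c) (A - {(Suc s, c)})"
  have "covers (kohnert_poset D0) A E"
    unfolding E_def
  proof (rule covers_long_move[OF D0(1) A(1)])
    show "(r, c) \<notin> A" "\<forall>x. r < x \<and> x \<le> Suc s \<longrightarrow> (x, c) \<in> A" "\<forall>c1>c. (Suc s, c1) \<notin> A"
      using r col unfolding A_def mem_lower_right by auto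
    show "\<forall>x. r < x \<and> x < Suc s \<longrightarrow> (\<exists>c1>c. (x, c1) \<in> A)"
    proof (intro allI impI)
      fix x
      assume x: "r < x \<and> x < Suc s"
      show "\<exists>c1>c. (x, c1) \<in> A"
      proof (cases "x = s")
        case True
        \<comment> \<open>Row \<open>s\<close> is blocked by \<open>(s, c')\<close>, just dropped
          from row \<open>Suc s\<close>.\<close>
        then show ?thesis using top unfolding A_def mem_lower_right by blast
      next
        case False
        then have "x < s" using x by simp
        then show ?thesis using blocked x unfolding A_def mem_lower_right by fastforce
      qed
    qed
  qed (use r in simp_all)
  then have short: "\<rho> D = \<rho> E + k + 1" using cov A(2) by simp
  define B where "B = insert (r, c) (D - {(s, c)})"
  have "kohnert_move s D = B"
    unfolding B_def by (rule kohnert_move_eqI) (use assms in auto)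
  then have B: "B \<in> KD D0" "B \<in> KD D"
    using KD.step[OF D0(2) s] KD.step[OF KD.refl s, of D] by simp_all
  have "B \<noteq> D" using r unfolding B_def by blast
  \<comment> \<open>This move need not be a cover; a strict drop of the rank suffices.\<close>
  then have DB: "\<rho> B < \<rho> D" using mono B D0(2) by (simp add: kohnert_poset_def)
  have RB: "{c1. c < c1 \<and> (Suc s, c1) \<in> B} = {c1. c < c1 \<and> (Suc s, c1) \<in> D}"
    using r unfolding B_def by auto
  have "\<forall>c1>c. \<not> ((s, c1) \<in> B \<and> (Suc s, c1) \<in> B)" using clear unfolding B_def by auto
  from ranked_lower_right[where \<rho> = \<rho>, OF cov D0(1) B(1) s this]
  have L: "lower_right s c B \<in> KD D0" "\<rho> B = \<rho> (lower_right s c B) + k"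
    unfolding RB k_def by auto
  \<comment> \<open>\<open>(s, c)\<close> was vacated in \<open>B\<close>, and
    \<open>(Suc s, c)\<close> is now rightmost in its row, so it falls by one row.\<close>
  have "covers (kohnert_poset D0) (lower_right s c B)
      (insert (s, c) (lower_right s c B - {(Suc s, c)}))"
    by (rule covers_unit_move[OF D0(1) L(1) s])
      (use r col in \<open>auto simp: mem_lower_right B_def\<close>)
  moreover have "insert (s, c) (lower_right s c B - {(Suc s, c)}) = E"
  proof (rule set_eqI, clarify)
    fix x c1
    show "(x, c1) \<in> insert (s, c) (lower_right s c B - {(Suc s, c)}) \<longleftrightarrow> (x, c1) \<in> E"
      by (cases "c1 = c") (use r col in \<open>auto simp: mem_lower_right E_def A_def B_def\<close>)
  qed
  ultimately have "\<rho> (lower_right s c B) = \<rho> E + 1" using cov by simp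
  \<comment> \<open>Both \<open>\<rho> D\<close> and \<open>\<rho> B\<close> equal
    \<open>\<rho> E + k + 1\<close>, against \<open>DB\<close>.\<close>
  then show False using short DB L(2) by simp
qed

theorem theorem3p5:
  fixes D0 D :: "cell set" and r r' c c' :: nat
  assumes "diagram D0"
    and "D \<in> KD D0"
    and "1 \<le> c" and "c < c'"
    and "1 \<le> r" and "r < r' - 1"
    and "(r', c') \<in> D" and "\<forall>c1 > c'. (r', c1) \<notin> D"
    and "\<forall>r1. r < r1 \<and> r1 \<le> r' \<longrightarrow> (r1, c) \<in> D"
    and "(r, c) \<notin> D"
    and "\<forall>r1. r < r1 \<and> r1 < r' - 1 \<longrightarrow> (\<exists>c1 > c. (r1, c1) \<in> D)"
    and "\<forall>c1 > c. \<exists>r1. 1 \<le> r1 \<and> r1 < r' \<and> (r1, c1) \<notin> D"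
  shows "\<not> ranked (kohnert_poset D0)"
proof -
  define s where "s = r' - 1"
  have s: "r' = Suc s" "r < s" using assms(6) unfolding s_def by auto
  have "\<forall>c1>c. \<exists>x\<ge>1. x \<le> s \<and> (x, c1) \<notin> D" using assms(12) unfolding s(1) less_Suc_eq_le by blast
  \<comment> \<open>The other hypotheses pass from \<open>D\<close> to \<open>E\<close>: column
    \<open>c\<close> and row \<open>Suc s\<close> are untouched, and rows below \<open>s\<close>
    keep their cells.\<close>
  from clear_row_right[OF assms(1,2) this] obtain E where E: "E \<in> KD D0" "\<forall>c1>c. (s, c1) \<notin> E"
    "\<forall>x c1. x \<noteq> s \<longrightarrow> (x, c1) \<in> D \<longrightarrow> (x, c1) \<in> E"
    "\<forall>x c1. c1 \<le> c \<or> s < x \<longrightarrow> ((x, c1) \<in> E \<longleftrightarrow> (x, c1) \<in> D)" by blast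
  show ?thesis
  proof (rule not_ranked_if_row_clear[OF assms(1) E(1) assms(5) s(2) _ assms(4) _ _ _ E(2)])
    show "(r, c) \<notin> E" "\<forall>x. r < x \<and> x \<le> Suc s \<longrightarrow> (x, c) \<in> E" "(Suc s, c') \<in> E"
      using E(4) assms(7,9,10) s(1) by auto
    have "\<exists>c1>c. (x, c1) \<in> E" if x: "r < x" "x < s" for x
    proof -
      obtain c1 where "c < c1" "(x, c1) \<in> D" using assms(11) x unfolding s_def by blast
      moreover from this have "(x, c1) \<in> E" using E(3) x(2) by simp
      ultimately show ?thesis by blast
    qed
    then show "\<forall>x. r < x \<and> x < s \<longrightarrow> (\<exists>c1>c. (x, c1) \<in> E)" by blast
  qed
qed

end
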